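(* Let $\varepsilon\in(0,1)$, let $n,d\ge1$ be integers, and assume $d=\Omega\!\left(\frac{\log n\,\log(n/\varepsilon)}{\varepsilon^2}\right)$. Then the space complexity of terminal embedding satisfies $\mathrm{embedsc}(n,d,\varepsilon)=\Omega(nd)$; that is, an $\varepsilon$-terminal embedding that maps a given dataset $P\subseteq\mathbb{R}^d$ of size $n$ to target dimension $O(\varepsilon^{-2}\log n)$ requires, in the worst case over $P$, at least $\Omega(nd)$ bits of space.
   Context: $\mathrm{dist}$ denotes Euclidean distance. For a dataset $P\subset\mathbb{R}^d$ of $n$ points and $\varepsilon\in(0,1)$, a mapping $\tau:\mathbb{R}^d\to\mathbb{R}^m$ is an $\varepsilon$-terminal embedding of $P$ if for all $p\in P$ and $q\in\mathbb{R}^d$, $\mathrm{dist}(p,q)\le\mathrm{dist}(\tau(p),\tau(q))\le(1+\varepsilon)\,\mathrm{dist}(p,q)$. $\mathrm{embedsc}(P,d,\varepsilon)$ is the minimum possible number of bits of (i.e. needed to store) an $\varepsilon$-terminal embedding of $P$ into $\mathbb{R}^m$ with $m=O(\varepsilon^{-2}\log n)$, and $\mathrm{embedsc}(n,d,\varepsilon)=\sup_{P\subset\mathbb{R}^d:\,|P|=n}\mathrm{embedsc}(P,d,\varepsilon)$. The hypothesis $d=\Omega(X)$ means $d\ge C_0X$ for a sufficiently large absolute constant $C_0$. *)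

theory Defs
  imports "HOL-Analysis.Analysis"
begin

text \<open>
  The dimension is quantified inside the statement, so points of \<open>d\<close>-dimensional space are
  the elements of the topspace of \<^const>\<open>Euclidean_space\<close> \<open>d\<close>: functions on the natural numbers
  that vanish from index \<open>d\<close> on.
\<close>

abbreviation Rn :: "nat \<Rightarrow> (nat \<Rightarrow> real) set" where
  "Rn d \<equiv> topspace (Euclidean_space d)"

definition edist :: "nat \<Rightarrow> (nat \<Rightarrow> real) \<Rightarrow> (nat \<Rightarrow> real) \<Rightarrow> real" where
  "edist d x y = L2_set (\<lambda>i. x i - y i) {..<d}"

definition terminal_embedding ::
  "real \<Rightarrow> nat \<Rightarrow> nat \<Rightarrow> (nat \<Rightarrow> real) set \<Rightarrow> ((nat \<Rightarrow> real) \<Rightarrow> (nat \<Rightarrow> real)) \<Rightarrow> bool" where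
  "terminal_embedding \<epsilon> d m P \<tau> \<longleftrightarrow>
     \<tau> \<in> Rn d \<rightarrow> Rn m \<and>
     (\<forall>p\<in>P. \<forall>q\<in>Rn d.
        edist d p q \<le> edist m (\<tau> p) (\<tau> q) \<and>
        edist m (\<tau> p) (\<tau> q) \<le> (1 + \<epsilon>) * edist d p q)"

text \<open>
  The number of bits that a map occupies only makes sense relative to a storage scheme, that is,
  a rule that turns a bit string into the map it represents (target dimension and function).
  A scheme may be an arbitrary function, without computability or prefix-freeness requirements,
  and it may depend on \<open>n\<close>, \<open>d\<close>, \<open>\<epsilon>\<close>, but not on the dataset.
\<close>

type_synonym scheme = "bool list \<Rightarrow> nat \<times> ((nat \<Rightarrow> real) \<Rightarrow> (nat \<Rightarrow> real))"

text \<open>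
  Least number of bits in which the scheme \<open>D\<close> stores some \<open>\<epsilon>\<close>-terminal embedding of the finite
  dataset \<open>P\<close> into a target dimension \<open>m\<close> of order \<open>ln n / \<epsilon>\<^sup>2\<close>, where \<open>n\<close> is the cardinality of \<open>P\<close>
  and \<open>K\<close> is the constant hidden in the order of \<open>m\<close>.
  The value is \<open>\<infinity>\<close> if no string stores such an embedding.
\<close>

definition embedsc_dataset ::
  "scheme \<Rightarrow> real \<Rightarrow> (nat \<Rightarrow> real) set \<Rightarrow> nat \<Rightarrow> real \<Rightarrow> enat" where
  "embedsc_dataset D K P d \<epsilon> =
     (INF s \<in> {s. real (fst (D s)) \<le> K * (ln (real (card P)) / \<epsilon>\<^sup>2) \<and>
                   terminal_embedding \<epsilon> d (fst (D s)) P (snd (D s))}.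
        enat (length s))"

text \<open>Worst case over the datasets of size \<open>n\<close>, for the best scheme.\<close>

definition embedsc :: "real \<Rightarrow> nat \<Rightarrow> nat \<Rightarrow> real \<Rightarrow> enat" where
  "embedsc K n d \<epsilon> =
     (INF D :: scheme. SUP P \<in> {P. P \<subseteq> Rn d \<and> finite P \<and> card P = n}. embedsc_dataset D K P d \<epsilon>)"

end

theory Submission
  imports Defs
begin

text \<open>
  A map stored by one bit string serves only the datasets contained in the set \<open>T\<close> of all
  vertices of the cube \<open>{0,1}\<^sup>d\<close> that it treats correctly as terminals. The images of \<open>T\<close> are
  1-separated and have diameter at most \<open>2d\<close> in dimension \<open>m\<close>, so a grid argument bounds
  \<open>|T|\<close> by \<open>(4dm + 1)\<^sup>m\<close>. The assumption on \<open>d\<close> makes this at most \<open>exp (d/4)\<close>, exponentially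
  smaller than \<open>2\<^sup>d\<close>. Since there are at least \<open>(2\<^sup>d/n)\<^sup>n\<close> datasets of size \<open>n\<close> in the cube and
  each string serves at most \<open>|T|\<^sup>n\<close> of them, \<open>\<Omega>(nd)\<close> bits are necessary.
\<close>

section \<open>Separated sets of bounded diameter\<close>

lemma edist_ge_coord: "i < d \<Longrightarrow> \<bar>x i - y i\<bar> \<le> edist d x y"
  unfolding edist_def using member_le_L2_set[of "{..<d}" i "\<lambda>i. \<bar>x i - y i\<bar>"]
  by (simp add: L2_set_def)

lemma edist_le_sum: "edist d x y \<le> (\<Sum>i<d. \<bar>x i - y i\<bar>)"
  unfolding edist_def by (rule L2_set_le_sum_abs)

text \<open>In a grid of side \<open>1 / m\<close>, points of one cell differ by less than
  \<open>1 / m\<close> in each coordinate, hence by less than 1 in the l1 norm, which dominates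
  \<open>edist\<close>. So a cell holds at most one point, and centring the grid at a point of
  \<open>T\<close> leaves \<open>2 * R * m + 1\<close> indices per coordinate.\<close>

lemma card_separated_le:
  fixes f :: "'a \<Rightarrow> nat \<Rightarrow> real" and R :: nat
  assumes sep: "\<And>p q. p \<in> T \<Longrightarrow> q \<in> T \<Longrightarrow> p \<noteq> q \<Longrightarrow> 1 \<le> edist m (f p) (f q)"
    and diam: "\<And>p q. p \<in> T \<Longrightarrow> q \<in> T \<Longrightarrow> edist m (f p) (f q) \<le> real R"
  shows "card T \<le> (2 * R * m + 1) ^ m"
proof (cases "T = {}")
  case False
  then obtain p\<^sub>0 where p0: "p\<^sub>0 \<in> T" by blast
  define cell where "cell p = (\<lambda>i\<in>{..<m}. \<lfloor>(f p i - f p\<^sub>0 i) * real m\<rfloor>)" for p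
  define B where "B = {- int (R * m)..int (R * m)}"
  have maps: "cell ` T \<subseteq> {..<m} \<rightarrow>\<^sub>E B"
  proof (intro image_subsetI PiE_I)
    fix p i assume p: "p \<in> T" and i: "i \<in> {..<m}"
    have "\<bar>f p i - f p\<^sub>0 i\<bar> \<le> real R"
      using edist_ge_coord[of i m "f p" "f p\<^sub>0"] diam[OF p p0] i by simp
    hence "\<bar>f p i - f p\<^sub>0 i\<bar> * real m \<le> real R * real m"
      by (intro mult_right_mono) auto
    hence "\<bar>(f p i - f p\<^sub>0 i) * real m\<bar> \<le> real R * real m"
      by (simp add: abs_mult)
    hence "\<bar>(f p i - f p\<^sub>0 i) * real m\<bar> \<le> real (R * m)"
      by simp
    hence "real_of_int (- int (R * m)) \<le> (f p i - f p\<^sub>0 i) * real m"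
      "(f p i - f p\<^sub>0 i) * real m < real_of_int (int (R * m)) + 1"
      unfolding of_int_minus of_int_of_nat_eq by linarith+
    hence "\<lfloor>(f p i - f p\<^sub>0 i) * real m\<rfloor> \<in> B"
      unfolding B_def atLeastAtMost_iff le_floor_iff floor_le_iff by blast
    thus "cell p i \<in> B"
      using i by (simp add: cell_def)
  qed (auto simp: cell_def)
  have inj: "inj_on cell T"
  proof (rule inj_onI, rule ccontr)
    fix p q assume p: "p \<in> T" and q: "q \<in> T" and eq: "cell p = cell q" and ne: "p \<noteq> q"
    \<comment> \<open>In dimension 0 every distance is an empty sum, so two separated points exclude
      \<open>m = 0\<close>.\<close>
    have m: "m > 0"
      using sep[OF p q ne] by (cases m) (auto simp: edist_def)
    have "\<bar>f p i - f q i\<bar> < 1 / real m" if "i < m" for i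
    proof -
      have "\<lfloor>(f p i - f p\<^sub>0 i) * real m\<rfloor> = \<lfloor>(f q i - f p\<^sub>0 i) * real m\<rfloor>"
        using fun_cong[OF eq, of i] that by (simp add: cell_def)
      hence "\<bar>(f p i - f p\<^sub>0 i) * real m - (f q i - f p\<^sub>0 i) * real m\<bar> < 1"
        by linarith
      hence "\<bar>(f p i - f q i) * real m\<bar> < 1"
        by (simp add: algebra_simps)
      hence "\<bar>f p i - f q i\<bar> * real m < 1"
        by (simp only: abs_mult abs_of_nat)
      thus ?thesis
        using m by (simp add: pos_less_divide_eq)
    qed
    hence "(\<Sum>i<m. \<bar>f p i - f q i\<bar>) < (\<Sum>i<m. 1 / real m)"
      using m by (intro sum_strict_mono) auto
    also have "\<dots> = 1" using m by simp
    finally show False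
      using sep[OF p q ne] edist_le_sum[of m "f p" "f q"] by linarith
  qed
  have "card T \<le> card ({..<m} \<rightarrow>\<^sub>E B)"
    using inj maps by (rule card_inj_on_le) (auto intro!: finite_PiE simp: B_def)
  also have "\<dots> = card B ^ m"
    by (simp add: card_PiE)
  also have "card B = 2 * R * m + 1"
    by (simp add: B_def nat_add_distrib nat_mult_distrib)
  finally show ?thesis .
qed simp

section \<open>Vertices of the unit cube\<close>

definition cube :: "nat \<Rightarrow> (nat \<Rightarrow> real) set" where
  "cube d = (\<lambda>A i. of_bool (i \<in> A)) ` Pow {..<d}"

lemma finite_cube [simp]: "finite (cube d)"
  by (simp add: cube_def)

lemma card_cube: "card (cube d) = 2 ^ d"
proof -
  have "inj_on (\<lambda>A i. of_bool (i \<in> A) :: real) (Pow {..<d})"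
    by (rule inj_onI) (auto simp: fun_eq_iff of_bool_eq_iff)
  thus ?thesis
    by (simp add: cube_def card_image card_Pow)
qed

lemma cube_subset_Rn: "cube d \<subseteq> Rn d"
  by (auto simp: cube_def topspace_Euclidean_space)

lemma edist_cube_le:
  assumes "x \<in> cube d" "y \<in> cube d"
  shows "edist d x y \<le> real d"
proof -
  have "(\<Sum>i<d. \<bar>x i - y i\<bar>) \<le> (\<Sum>i<d. 1)"
    using assms by (intro sum_mono) (auto simp: cube_def)
  thus ?thesis
    using edist_le_sum[of d x y] by simp
qed

lemma edist_cube_ge:
  assumes "x \<in> cube d" "y \<in> cube d" "x \<noteq> y"
  shows "1 \<le> edist d x y"
proof -
  obtain i where i: "x i \<noteq> y i"
    using assms(3) by blast
  hence "i < d" "\<bar>x i - y i\<bar> = 1"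
    using assms(1,2) by (auto simp: cube_def of_bool_def split: if_splits)
  thus ?thesis
    using edist_ge_coord[of i d x y] by simp
qed

section \<open>Counting datasets against bit strings\<close>

lemma card_bool_lists_length_le: "card {s :: bool list. length s \<le> l} \<le> 2 ^ (l + 1)"
proof -
  have "card {s :: bool list. length s \<le> l} = (\<Sum>i\<le>l. 2 ^ i)"
    using card_lists_length_le[of "UNIV :: bool set" l] by simp
  also have "\<dots> \<le> 2 ^ (l + 1)"
    by (induction l) auto
  finally show ?thesis .
qed

text \<open>A union bound over the strings of length at most \<open>l\<close> in \<open>S\<close>.
  The set \<open>S\<close> stands for the strings whose target dimension is admissible, since only
  for these is \<open>T s\<close> known to be small.\<close>

lemma binomial_le_strings_mult_power:
  fixes G :: "'a set" and T :: "bool list \<Rightarrow> 'a set"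
  assumes fin: "finite G" "\<And>s. T s \<subseteq> G"
    and small: "\<And>s. s \<in> S \<Longrightarrow> card (T s) \<le> t"
    and cover: "\<And>P. P \<subseteq> G \<Longrightarrow> card P = n \<Longrightarrow> \<exists>s\<in>S. length s \<le> l \<and> P \<subseteq> T s"
  shows "card G choose n \<le> 2 ^ (l + 1) * t ^ n"
proof -
  define S' where "S' = {s \<in> S. length s \<le> l}"
  have S': "S' \<subseteq> {s. length s \<le> l}" and finL: "finite {s :: bool list. length s \<le> l}"
    using finite_lists_length_le[of "UNIV :: bool set" l] by (auto simp: S'_def)
  have finT: "finite (T s)" for s
    using fin finite_subset by blast
  have served: "card {P. P \<subseteq> T s \<and> card P = n} \<le> t ^ n" if "s \<in> S'" for s
  proof -
    have "card {P. P \<subseteq> T s \<and> card P = n} = card (T s) choose n"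
      by (rule n_subsets[OF finT])
    also have "\<dots> \<le> card (T s) ^ n"
      by (cases "n \<le> card (T s)") (auto simp: binomial_le_pow binomial_eq_0)
    also have "\<dots> \<le> t ^ n"
      using small that by (intro power_mono) (auto simp: S'_def)
    finally show ?thesis .
  qed
  have "card G choose n = card {P. P \<subseteq> G \<and> card P = n}"
    using n_subsets[OF fin(1)] by simp
  also have "\<dots> \<le> card (\<Union>s\<in>S'. {P. P \<subseteq> T s \<and> card P = n})"
  proof (rule card_mono)
    show "finite (\<Union>s\<in>S'. {P. P \<subseteq> T s \<and> card P = n})"
      using finT finite_subset[OF S' finL] by auto
    show "{P. P \<subseteq> G \<and> card P = n} \<subseteq> (\<Union>s\<in>S'. {P. P \<subseteq> T s \<and> card P = n})"
      using cover unfolding S'_def by blast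
  qed
  also have "\<dots> \<le> (\<Sum>s\<in>S'. card {P. P \<subseteq> T s \<and> card P = n})"
    by (rule card_UN_le[OF finite_subset[OF S' finL]])
  also have "\<dots> \<le> card S' * t ^ n"
    using sum_mono[of S', OF served] by simp
  also have "\<dots> \<le> 2 ^ (l + 1) * t ^ n"
    using card_mono[OF finL S'] card_bool_lists_length_le[of l] by (intro mult_right_mono) auto
  finally show ?thesis .
qed

text \<open>Taking logarithms gives \<open>l + 1\<close> at least \<open>n * d\<close> times 2/3 -
  1/16 - 1/4 = 17/48. The excess of 17/48 over 1/4, with \<open>n * d \<ge> 16\<close>, absorbs the
  1.\<close>

lemma string_length_lower_bound:
  fixes t :: nat
  assumes count: "(2 ^ d) choose n \<le> 2 ^ (l + 1) * t ^ n"
    and t: "real t \<le> exp (real d / 4)" and n: "ln (real n) \<le> real d / 16" "n \<ge> 1"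
    and d: "d \<ge> 16"
  shows "real n * real d / 4 \<le> real l"
proof -
  have ln2: "2 / 3 \<le> ln (2 :: real)" "ln (2 :: real) \<le> 1"
    using ln2_ge_two_thirds ln_le_minus_one[of 2] by auto
  \<comment> \<open>The lower bound \<open>(N / n) ^ n\<close> for the binomial coefficient
    \<open>N choose n\<close> requires \<open>n \<le> N\<close>, here with
    \<open>N = 2 ^ d\<close>.\<close>
  have "real n = exp (ln (real n))"
    using n by simp
  also have "\<dots> \<le> exp (real d * ln 2)"
    using n ln2 mult_left_mono[of "2/3" "ln 2" "real d"] by (subst exp_le_cancel_iff) simp
  also have "\<dots> = real (2 ^ d)"
    by (simp add: exp_of_nat_mult)
  finally have "n \<le> 2 ^ d"
    by (simp only: of_nat_le_iff)
  hence "(real (2 ^ d) / real n) ^ n \<le> real ((2 ^ d) choose n)"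
    by (rule binomial_ge_n_over_k_pow_k)
  also have "\<dots> \<le> real (2 ^ (l + 1) * t ^ n)"
    using count by (simp only: of_nat_le_iff)
  also have "\<dots> = 2 ^ (l + 1) * real t ^ n"
    by simp
  also have "\<dots> \<le> 2 ^ (l + 1) * exp (real d / 4) ^ n"
    using t by (intro mult_left_mono power_mono) auto
  finally have "ln ((2 ^ d / real n) ^ n) \<le> ln (2 ^ (l + 1) * exp (real d / 4) ^ n)"
    using n by (subst ln_le_cancel_iff) auto
  hence "real n * (real d * ln 2 - ln (real n)) \<le> (real l + 1) * ln 2 + real n * (real d / 4)"
    using n by (simp add: ln_mult ln_div ln_realpow add.commute del: power_Suc)
  moreover have "real n * (real d * (2/3) - real d / 16) \<le> real n * (real d * ln 2 - ln (real n))"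
    using n ln2 by (intro mult_left_mono diff_mono) auto
  moreover have "(real l + 1) * ln 2 \<le> real l + 1"
    using ln2 mult_left_mono[of "ln 2" 1 "real l + 1"] by simp
  moreover have "16 \<le> real n * real d"
    using n d mult_mono[of 1 "real n" 16 "real d"] by simp
  ultimately show ?thesis
    by (simp add: field_simps)
qed

section \<open>Calibrating the hypothesis on the dimension\<close>

text \<open>
  Writing \<open>5d = y z\<close> with \<open>z = t ln n ln (n/\<epsilon>) / \<epsilon>\<^sup>2\<close>, the choice \<open>t = 160K + 1\<close> makes the contribution
  of \<open>ln y \<le> y\<close> to \<open>m ln (5d)\<close> small, and \<open>ln z \<le> (2t + 3) ln (n/\<epsilon>)\<close> determines the constant below.
\<close>

definition dim_const :: "real \<Rightarrow> real" where
  "dim_const K = 64 + 16 * K * (2 * (160 * K + 1) + 3)"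

text \<open>The first two bounds are conditions of \<open>string_length_lower_bound\<close>; the
  last controls the cell count of \<open>card_separated_le\<close> for \<open>R = 2 * d\<close>.
  With \<open>A = ln n / \<epsilon>\<^sup>2\<close>, that count reduces to
  \<open>K * A * ln (5 * d) \<le> d / 8\<close>.\<close>

lemma dim_const_bounds:
  assumes K: "K > 0" and \<epsilon>: "0 < \<epsilon>" "\<epsilon> < 1" and n: "n \<ge> 2"
    and d: "dim_const K * (ln (real n) * ln (real n / \<epsilon>) / \<epsilon>\<^sup>2) \<le> real d"
    and m: "real m \<le> K * (ln (real n) / \<epsilon>\<^sup>2)"
  shows "d \<ge> 16" "ln (real n) \<le> real d / 16"
    "real ((4 * d * m + 1) ^ m) \<le> exp (real d / 4)"
proof -
  define A where "A = ln (real n) / \<epsilon>\<^sup>2"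
  define L where "L = ln (real n / \<epsilon>)"
  have n': "real n \<ge> 2" using n by simp
  have ln_n: "1 / 2 \<le> ln (real n)"
  proof -
    have "ln 2 \<le> ln (real n)" using n' by simp
    thus ?thesis using ln2_ge_two_thirds by linarith
  qed
  have "\<epsilon>\<^sup>2 \<le> 1" using \<epsilon> by (simp add: power_le_one)
  hence A_ge: "ln (real n) \<le> A"
    using \<epsilon> ln_n mult_left_mono[of "\<epsilon>\<^sup>2" 1 "ln (real n)"] by (simp add: A_def field_simps)
  have "real n \<le> real n / \<epsilon>"
    using \<epsilon> n' by (simp add: field_simps)
  hence L: "1 / 2 \<le> L"
    using ln_n n' ln_mono[of "real n" "real n / \<epsilon>"] unfolding L_def by linarith
  have A: "1 / 2 \<le> A" using A_ge ln_n by linarith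
  have AL: "A / 2 \<le> A * L"
    using mult_left_mono[OF L, of A] A by simp
  have dAL: "dim_const K * (A * L) \<le> real d"
    using d by (simp add: A_def L_def field_simps)
  have KK: "0 < K * K" using K by simp
  \<comment> \<open>The summand 64 yields \<open>d \<ge> 64 * A * L \<ge> 32 * A \<ge> 16\<close>;
    the bound by \<open>2 * K\<close> yields \<open>m \<le> K * A \<le> d\<close>.\<close>
  have C: "64 \<le> dim_const K" "2 * K \<le> dim_const K"
    using K KK by (auto simp: dim_const_def algebra_simps)
  have d64: "64 * (A * L) \<le> real d"
    using mult_right_mono[OF C(1), of "A * L"] dAL AL A by linarith
  show "d \<ge> 16" using d64 AL A by linarith
  have dA: "32 * A \<le> real d" using d64 AL by linarith
  show "ln (real n) \<le> real d / 16" using dA A_ge A by linarith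
  have m': "real m \<le> K * A" using m by (simp add: A_def)
  have "real m \<le> real d"
    using m' mult_right_mono[OF C(2), of "A * L"] dAL AL A mult_left_mono[OF AL, of K] K by linarith
  hence md: "m \<le> d" by simp
  show "real ((4 * d * m + 1) ^ m) \<le> exp (real d / 4)"
  proof (cases "m = 0")
    case False
    define t where "t = 160 * K + 1"
    have t: "t > 1" using K by (simp add: t_def)
    have dpos: "real d > 0" using dA A by linarith
    define z where "z = t * A * L"
    define y where "y = 5 * real d / z"
    have z: "z > 0" using t A L by (simp add: z_def)
    have y: "y > 0" using z dpos by (simp add: y_def)
    \<comment> \<open>The logarithm splits into \<open>ln t \<le> t \<le> 2 * t * L\<close>,
      \<open>ln A \<le> 2 * L\<close> and \<open>ln L \<le> L\<close>.\<close>
    have "ln z \<le> (2 * t + 3) * L"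
    proof -
      have "A \<le> (real n / \<epsilon>)\<^sup>2"
      proof -
        have "ln (real n) \<le> real n" using ln_le_minus_one[of "real n"] n' by linarith
        also have "\<dots> \<le> (real n)\<^sup>2" using n' by (simp add: power2_eq_square)
        finally show ?thesis
          using \<epsilon> by (simp add: A_def power_divide divide_right_mono)
      qed
      hence "ln A \<le> ln ((real n / \<epsilon>)\<^sup>2)"
        using A n' \<epsilon> by (subst ln_le_cancel_iff) auto
      also have "\<dots> = 2 * L"
        using \<epsilon> n' by (simp add: L_def ln_realpow)
      finally have "ln A \<le> 2 * L" .
      moreover have "ln L \<le> L" using ln_le_minus_one[of L] L by linarith
      moreover have "ln t \<le> t" using ln_le_minus_one[of t] t by linarith
      moreover have "t \<le> 2 * t * L" using mult_left_mono[OF L, of "2 * t"] t by simp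
      moreover have "ln z = ln t + ln A + ln L"
        using t A L by (simp add: z_def ln_mult)
      ultimately show ?thesis by (simp add: algebra_simps)
    qed
    hence "K * A * ln z \<le> K * A * ((2 * t + 3) * L)"
      using K A by (intro mult_left_mono) auto
    also have "\<dots> \<le> real d / 16"
    proof -
      have "16 * K * (2 * t + 3) \<le> dim_const K"
        by (simp add: dim_const_def t_def)
      hence "16 * K * (2 * t + 3) * (A * L) \<le> real d"
        using mult_right_mono[of "16 * K * (2 * t + 3)" "dim_const K" "A * L"] dAL AL A by linarith
      thus ?thesis by (simp add: algebra_simps)
    qed
    finally have zb: "K * A * ln z \<le> real d / 16" .
    have "K * A * ln y \<le> K * A * y"
      using K A y ln_le_minus_one[OF y] by (intro mult_left_mono) auto
    also have "\<dots> = 5 * K * real d / (t * L)"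
      using A by (simp add: y_def z_def)
    also have "\<dots> \<le> real d / 16"
    proof -
      \<comment> \<open>Here 160 in \<open>t\<close> is used:
        \<open>t * L \<ge> t / 2 \<ge> 80 * K\<close>, and 5/80 = 1/16.\<close>
      have "80 * K \<le> t * L"
        using mult_left_mono[OF L, of t] t t_def by linarith
      thus ?thesis
        using t L mult_right_mono[of "80 * K" "t * L" "real d"] by (simp add: field_simps)
    qed
    finally have yb: "K * A * ln y \<le> real d / 16" .
    have "5 * real d = y * z" using z by (simp add: y_def)
    hence "K * A * ln (5 * real d) = K * A * ln y + K * A * ln z"
      using y z by (simp add: ln_mult algebra_simps)
    hence yz: "K * A * ln (5 * real d) \<le> real d / 8"
      using zb yb by linarith
    \<comment> \<open>Bounding the base by a square costs only a factor 2 in the logarithm and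
      brings back \<open>ln (5 * d)\<close>. The summand 1 is at most \<open>d * d\<close> because
      \<open>0 < m \<le> d\<close>.\<close>
    have "4 * d * m + 1 \<le> 4 * (d * d) + d * d"
      using md False by (intro add_mono) auto
    hence "4 * d * m + 1 \<le> (5 * d)\<^sup>2"
      by (simp add: power2_eq_square)
    hence "real (4 * d * m + 1) \<le> (5 * real d)\<^sup>2"
      using of_nat_le_iff[where ?'a = real, of "4 * d * m + 1" "(5 * d)\<^sup>2"] by simp
    hence "ln (real (4 * d * m + 1)) \<le> ln ((5 * real d)\<^sup>2)"
      by (rule ln_mono) (simp only: of_nat_0_less_iff)
    hence "ln (real (4 * d * m + 1)) \<le> 2 * ln (5 * real d)"
      using dpos ln_realpow[of "5 * real d" 2] by linarith
    hence "real m * ln (real (4 * d * m + 1)) \<le> real m * (2 * ln (5 * real d))"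
      by (intro mult_left_mono) auto
    also have "\<dots> \<le> K * A * (2 * ln (5 * real d))"
      using m' dA A ln_ge_zero[of "5 * real d"] by (intro mult_right_mono) linarith+
    also have "\<dots> \<le> real d / 4" using yz by simp
    finally have "exp (real m * ln (real (4 * d * m + 1))) \<le> exp (real d / 4)" by simp
    moreover have "0 < real (4 * d * m + 1)" by (simp only: of_nat_0_less_iff)
    ultimately show ?thesis
      by (simp only: exp_of_nat_mult exp_ln of_nat_power)
  qed simp
qed

section \<open>From hard datasets to the space complexity\<close>

text \<open>All distances vanish in dimension 0, but a terminal must be kept apart from every other
  point of the space, even if it is the only terminal. This settles \<open>n = 1\<close>, where
  \<open>ln n = 0\<close> forces target dimension 0.\<close>

lemma no_terminal_embedding_dim_0:
  assumes "d \<ge> 1" "p \<in> P" "P \<subseteq> Rn d"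
  shows "\<not> terminal_embedding \<epsilon> d 0 P \<tau>"
proof
  assume emb: "terminal_embedding \<epsilon> d 0 P \<tau>"
  define q where "q = p(0 := p 0 + 1)"
  have "q \<in> Rn d"
    using assms by (auto simp: q_def topspace_Euclidean_space)
  hence "edist d p q \<le> edist 0 (\<tau> p) (\<tau> q)"
    using emb assms(2) by (simp add: terminal_embedding_def)
  moreover have "1 \<le> edist d p q"
    using edist_ge_coord[of 0 d p q] assms(1) by (simp add: q_def)
  ultimately show False
    by (simp add: edist_def)
qed

text \<open>The infimum over schemes is outermost, so the hard dataset may depend on the scheme. If
  no string stores a suitable embedding, the cost is \<infinity> and the bound holds.\<close>

lemma embedsc_geI:
  assumes "\<And>D :: scheme. \<exists>P. P \<subseteq> Rn d \<and> finite P \<and> card P = n \<and>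
    (\<forall>s. real (fst (D s)) \<le> K * (ln (real n) / \<epsilon>\<^sup>2) \<longrightarrow>
         terminal_embedding \<epsilon> d (fst (D s)) P (snd (D s)) \<longrightarrow> b \<le> real (length s))"
  shows "ereal b \<le> ereal_of_enat (embedsc K n d \<epsilon>)"
proof -
  \<comment> \<open>Lengths are natural numbers, so rounding \<open>b\<close> up loses nothing and
    allows a comparison in \<open>enat\<close>.\<close>
  have bits: "enat (nat \<lceil>b\<rceil>) \<le> embedsc K n d \<epsilon>"
    unfolding embedsc_def
  proof (rule INF_greatest)
    fix D :: scheme
    obtain P where P: "P \<in> {P. P \<subseteq> Rn d \<and> finite P \<and> card P = n}"
      and lower: "\<And>s. real (fst (D s)) \<le> K * (ln (real n) / \<epsilon>\<^sup>2) \<Longrightarrow>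
         terminal_embedding \<epsilon> d (fst (D s)) P (snd (D s)) \<Longrightarrow> b \<le> real (length s)"
      using assms[of D] by blast
    have "enat (nat \<lceil>b\<rceil>) \<le> embedsc_dataset D K P d \<epsilon>"
      unfolding embedsc_dataset_def using P lower
      by (intro INF_greatest) (auto simp: nat_le_iff ceiling_le_iff)
    thus "enat (nat \<lceil>b\<rceil>) \<le> (SUP P \<in> {P. P \<subseteq> Rn d \<and> finite P \<and> card P = n}.
        embedsc_dataset D K P d \<epsilon>)"
      using P by (rule SUP_upper2[rotated])
  qed
  have "ereal b \<le> ereal_of_enat (enat (nat \<lceil>b\<rceil>))"
    by (simp add: real_nat_ceiling_ge)
  also have "\<dots> \<le> ereal_of_enat (embedsc K n d \<epsilon>)"
    using bits by (simp only: ereal_of_enat_le_iff)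
  finally show ?thesis .
qed

theorem theorem1p5:
  fixes K :: real
  assumes "K > 0"
  shows "\<exists>C\<^sub>0 > 0. \<exists>c > 0. \<forall>(\<epsilon> :: real) (n :: nat) (d :: nat).
           0 < \<epsilon> \<longrightarrow> \<epsilon> < 1 \<longrightarrow> n \<ge> 1 \<longrightarrow> d \<ge> 1 \<longrightarrow>
           real d \<ge> C\<^sub>0 * (ln (real n) * ln (real n / \<epsilon>) / \<epsilon>\<^sup>2) \<longrightarrow>
           ereal (c * (real n * real d)) \<le> ereal_of_enat (embedsc K n d \<epsilon>)"
proof -
  have bound: "ereal (1/4 * (real n * real d)) \<le> ereal_of_enat (embedsc K n d \<epsilon>)"
    if \<epsilon>: "0 < \<epsilon>" "\<epsilon> < 1" and n: "n \<ge> 1" and d: "d \<ge> 1"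
      and dim: "dim_const K * (ln (real n) * ln (real n / \<epsilon>) / \<epsilon>\<^sup>2) \<le> real d"
    for \<epsilon> :: real and n d :: nat
  proof (rule embedsc_geI)
    fix D :: scheme
    define valid where "valid s \<longleftrightarrow> real (fst (D s)) \<le> K * (ln (real n) / \<epsilon>\<^sup>2)" for s
    define serves where "serves s P \<longleftrightarrow> terminal_embedding \<epsilon> d (fst (D s)) P (snd (D s))" for s P
    have "\<exists>P. P \<subseteq> Rn d \<and> finite P \<and> card P = n \<and>
      (\<forall>s. valid s \<longrightarrow> serves s P \<longrightarrow> 1/4 * (real n * real d) \<le> real (length s))"
    proof (cases "n = 1")
      case True
      define P where "P = {\<lambda>_ :: nat. 0 :: real}"
      have P: "P \<subseteq> Rn d" "finite P" "card P = n"
        using True by (auto simp: P_def topspace_Euclidean_space)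
      have "\<not> serves s P" if "valid s" for s
        using no_terminal_embedding_dim_0[OF d _ P(1)] that True
        by (auto simp: valid_def serves_def P_def)
      with P show ?thesis by blast
    next
      case False
      hence n2: "n \<ge> 2" using n by simp
      note bounds = dim_const_bounds[OF \<open>K > 0\<close> \<epsilon> n2 dim]
      define t where "t = nat \<lfloor>exp (real d / 4)\<rfloor>"
      \<comment> \<open>The terminal property enters here: each \<open>p\<close> is tested against
        all vertices \<open>q\<close>, not only those of one dataset. Thus all cube datasets served
        by \<open>s\<close> lie in one set whose pairwise distances are preserved up to
        \<open>1 + \<epsilon>\<close>.\<close>
      define T where "T s = {p \<in> cube d. \<forall>q\<in>cube d.
          edist d p q \<le> edist (fst (D s)) (snd (D s) p) (snd (D s) q) \<and>
          edist (fst (D s)) (snd (D s) p) (snd (D s) q) \<le> (1 + \<epsilon>) * edist d p q}" for s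
      have T: "card (T s) \<le> t" if "s \<in> Collect valid" for s
      proof -
        \<comment> \<open>Cube distances lie between 1 and \<open>d\<close> and
          \<open>1 + \<epsilon> < 2\<close>, so the images are 1-separated with diameter at most
          \<open>R = 2 * d\<close>.\<close>
        have "card (T s) \<le> (2 * (2 * d) * fst (D s) + 1) ^ fst (D s)"
        proof (rule card_separated_le[where f = "snd (D s)"])
          fix p q assume p: "p \<in> T s" and q: "q \<in> T s"
          hence G: "p \<in> cube d" "q \<in> cube d" by (auto simp: T_def)
          have "edist (fst (D s)) (snd (D s) p) (snd (D s) q) \<le> (1 + \<epsilon>) * edist d p q"
            using p G by (simp add: T_def)
          also have "\<dots> \<le> 2 * real d"
            using \<epsilon> edist_cube_le[OF G] by (intro mult_mono) (auto simp: edist_def)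
          finally show "edist (fst (D s)) (snd (D s) p) (snd (D s) q) \<le> real (2 * d)"
            by simp
          assume "p \<noteq> q"
          hence "1 \<le> edist d p q" using edist_cube_ge[OF G] by simp
          also have "\<dots> \<le> edist (fst (D s)) (snd (D s) p) (snd (D s) q)"
            using p G by (simp add: T_def)
          finally show "1 \<le> edist (fst (D s)) (snd (D s) p) (snd (D s) q)" .
        qed
        hence "real (card (T s)) \<le> real ((4 * d * fst (D s) + 1) ^ fst (D s))"
          by (simp only: of_nat_le_iff) simp
        also have "\<dots> \<le> exp (real d / 4)"
          using that by (intro bounds(3)) (simp add: valid_def)
        finally show ?thesis
          by (simp add: t_def le_nat_floor)
      qed
      have t: "real t \<le> exp (real d / 4)"
        by (simp add: t_def)
      \<comment> \<open>Taking \<open>m = 0\<close> in \<open>dim_const_bounds\<close> yields its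
        two bounds that do not mention \<open>m\<close>.\<close>
      have zero: "real 0 \<le> K * (ln (real n) / \<epsilon>\<^sup>2)"
        using \<open>K > 0\<close> n by simp
      have "\<exists>P. P \<subseteq> cube d \<and> card P = n \<and>
        (\<forall>s. valid s \<longrightarrow> serves s P \<longrightarrow> 1/4 * (real n * real d) \<le> real (length s))"
      proof (rule ccontr)
        assume none: "\<not> ?thesis"
        \<comment> \<open>The largest natural number strictly below \<open>n * d / 4\<close>;
          positivity of \<open>n * d\<close> keeps the subtraction from truncating.\<close>
        define l where "l = nat \<lceil>real n * real d / 4\<rceil> - 1"
        have nd: "0 < real n * real d" using n d by simp
        have l: "real l < real n * real d / 4"
          using nd unfolding l_def by linarith
        have "\<exists>s\<in>Collect valid. length s \<le> l \<and> P \<subseteq> T s" if P: "P \<subseteq> cube d" "card P = n" for P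
        proof -
          obtain s where s: "valid s" "serves s P" "real (length s) < real n * real d / 4"
            using none P by (force simp: not_le)
          have "P \<subseteq> T s"
            using s(2) P(1) cube_subset_Rn[of d]
            unfolding T_def serves_def terminal_embedding_def by blast
          moreover have "length s \<le> l"
            using s(3) unfolding l_def by linarith
          ultimately show ?thesis using s by blast
        qed
        hence "card (cube d) choose n \<le> 2 ^ (l + 1) * t ^ n"
          by (intro binomial_le_strings_mult_power[where T = T and S = "Collect valid"] T)
            (auto simp: T_def)
        hence "real n * real d / 4 \<le> real l"
          unfolding card_cube
          by (rule string_length_lower_bound[OF _ t bounds(2)[OF zero] n bounds(1)[OF zero]])
        with l show False by simp
      qed
      then obtain P where "P \<subseteq> cube d" "card P = n"
        "\<forall>s. valid s \<longrightarrow> serves s P \<longrightarrow> 1/4 * (real n * real d) \<le> real (length s)"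
        by blast
      moreover from this have "P \<subseteq> Rn d" "finite P"
        using cube_subset_Rn finite_subset[OF _ finite_cube] by blast+
      ultimately show ?thesis by blast
    qed
    thus "\<exists>P. P \<subseteq> Rn d \<and> finite P \<and> card P = n \<and>
      (\<forall>s. real (fst (D s)) \<le> K * (ln (real n) / \<epsilon>\<^sup>2) \<longrightarrow>
         terminal_embedding \<epsilon> d (fst (D s)) P (snd (D s)) \<longrightarrow>
         1/4 * (real n * real d) \<le> real (length s))"
      by (simp add: valid_def serves_def)
  qed
  have "dim_const K > 0"
    using assms by (auto simp: dim_const_def intro!: add_pos_pos mult_pos_pos)
  thus ?thesis
    using bound by (intro exI[of _ "dim_const K"] exI[of _ "1/4 :: real"] conjI) auto
qed

end
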